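(* Let $(X,\mu,\mathcal{E},\mathcal{F})$ be a symmetric Dirichlet space with conservative semigroup $\{P_t\}_{t\ge0}$. Let $p\ge1$ and $\alpha>0$. For every $f\in\mathbf{B}^{p,\alpha}(X)$ and every $t\ge0$, \[ \|P_tf-f\|_{L^p(X,\mu)}\le t^\alpha\,\|f\|_{p,\alpha}. \]
   Context: $X$ is a topological space equipped with a Radon measure $\mu$; $\mathcal{E}$ is a symmetric Dirichlet form (closed Markovian symmetric bilinear form) on $L^2(X,\mu)$ with domain $\mathcal{F}$. $\{P_t\}_{t\ge0}$ is the associated Markovian semigroup, extended to a positive contraction semigroup on every $L^p(X,\mu)$. Standing assumption: $P_t$ is conservative, i.e. $P_t1=1$. For $p\ge1$, $\alpha\ge0$ and $f\in L^p(X,\mu)$ define \[ \|f\|_{p,\alpha}=\sup_{t>0}t^{-\alpha}\left(\int_X P_t(|f-f(y)|^p)(y)\,d\mu(y)\right)^{1/p}, \] where the inner expression is understood through the heat kernel measures of $P_t$; if $P_t$ has a heat kernel $p_t(x,y)$, the integral equals $\int_X\int_X|f(x)-f(y)|^pp_t(x,y)\,d\mu(x)\,d\mu(y)$. $\mathbf{B}^{p,\alpha}(X)=\{f\in L^p(X,\mu):\|f\|_{p,\alpha}<\infty\}$. *)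

theory Defs
  imports "HOL-Probability.Giry_Monad" "HOL-Probability.Essential_Supremum"
begin

text \<open>
  Elements of the Lebesgue spaces are represented by Borel functions, and identities between
  them hold almost everywhere.
\<close>

definition ennreal_powr :: "ennreal \<Rightarrow> real \<Rightarrow> ennreal" where
  "ennreal_powr x a = (if x = \<infinity> then \<infinity> else ennreal (enn2real x powr a))"

definition Lp_norm :: "'a measure \<Rightarrow> ennreal \<Rightarrow> ('a \<Rightarrow> real) \<Rightarrow> ennreal" where
  "Lp_norm M p f =
    (if p = \<infinity> then esssup M (\<lambda>x. ennreal \<bar>f x\<bar>)
     else ennreal_powr (\<integral>\<^sup>+x. ennreal (\<bar>f x\<bar> powr enn2real p) \<partial>M) (1 / enn2real p))"

definition Lp_space :: "'a measure \<Rightarrow> ennreal \<Rightarrow> ('a \<Rightarrow> real) set" where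
  "Lp_space M p = {f \<in> borel_measurable M. Lp_norm M p f < \<infinity>}"

definition L2_inner :: "'a measure \<Rightarrow> ('a \<Rightarrow> real) \<Rightarrow> ('a \<Rightarrow> real) \<Rightarrow> real" where
  "L2_inner M f g = (\<integral>x. f x * g x \<partial>M)"

text \<open>
  Compact sets need not be Borel when the space is not Hausdorff, hence the extra condition on
  \<open>K\<close>.
\<close>

definition radon_measure :: "'a::topological_space measure \<Rightarrow> bool" where
  "radon_measure M \<longleftrightarrow>
    sets M = sets borel \<and>
    (\<forall>x. \<exists>U. open U \<and> x \<in> U \<and> emeasure M U < \<infinity>) \<and>
    (\<forall>A\<in>sets M. emeasure M A = (SUP K\<in>{K. K \<subseteq> A \<and> compact K \<and> K \<in> sets M}. emeasure M K))"

locale dirichlet_form =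
  fixes M :: "'a measure"
    and F :: "('a \<Rightarrow> real) set"
    and E :: "('a \<Rightarrow> real) \<Rightarrow> ('a \<Rightarrow> real) \<Rightarrow> real"
  assumes domain_L2: "F \<subseteq> Lp_space M 2"
    and domain_linear: "\<And>a b f g. f \<in> F \<Longrightarrow> g \<in> F \<Longrightarrow> (\<lambda>x. a * f x + b * g x) \<in> F"
    and domain_cong_AE:
      "\<And>f g. f \<in> F \<Longrightarrow> g \<in> borel_measurable M \<Longrightarrow> (AE x in M. f x = g x) \<Longrightarrow> g \<in> F"
    and domain_dense:
      "\<And>f \<epsilon>. f \<in> Lp_space M 2 \<Longrightarrow> 0 < \<epsilon> \<Longrightarrow> \<exists>g\<in>F. Lp_norm M 2 (\<lambda>x. f x - g x) < ennreal \<epsilon>"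
    and form_cong_AE:
      "\<And>f g h. f \<in> F \<Longrightarrow> g \<in> F \<Longrightarrow> h \<in> F \<Longrightarrow> (AE x in M. f x = g x) \<Longrightarrow> E f h = E g h"
    and form_linear:
      "\<And>a b f g h. f \<in> F \<Longrightarrow> g \<in> F \<Longrightarrow> h \<in> F \<Longrightarrow>
        E (\<lambda>x. a * f x + b * g x) h = a * E f h + b * E g h"
    and form_symmetric: "\<And>f g. f \<in> F \<Longrightarrow> g \<in> F \<Longrightarrow> E f g = E g f"
    and form_nonneg: "\<And>f. f \<in> F \<Longrightarrow> 0 \<le> E f f"
    and form_closed:
      "\<And>u :: nat \<Rightarrow> 'a \<Rightarrow> real.
        (\<And>n. u n \<in> F) \<Longrightarrow>
        (\<And>\<epsilon>. 0 < \<epsilon> \<Longrightarrow> \<exists>N. \<forall>m\<ge>N. \<forall>n\<ge>N.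
          E (\<lambda>x. u m x - u n x) (\<lambda>x. u m x - u n x)
          + L2_inner M (\<lambda>x. u m x - u n x) (\<lambda>x. u m x - u n x) < \<epsilon>) \<Longrightarrow>
        \<exists>v\<in>F. (\<lambda>n. E (\<lambda>x. u n x - v x) (\<lambda>x. u n x - v x)
          + L2_inner M (\<lambda>x. u n x - v x) (\<lambda>x. u n x - v x)) \<longlonglongrightarrow> 0"
    and form_markovian:
      "\<And>f. f \<in> F \<Longrightarrow> (\<lambda>x. min 1 (max 0 (f x))) \<in> F \<and>
        E (\<lambda>x. min 1 (max 0 (f x))) (\<lambda>x. min 1 (max 0 (f x))) \<le> E f f"

text \<open>
  Compatibility with almost everywhere equality is not listed: it follows from linearity and
  contractivity, applied to \<open>f - g\<close>.
\<close>

definition contraction_semigroup_on ::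
    "'a measure \<Rightarrow> ennreal \<Rightarrow> (real \<Rightarrow> ('a \<Rightarrow> real) \<Rightarrow> 'a \<Rightarrow> real) \<Rightarrow> bool" where
  "contraction_semigroup_on M q P \<longleftrightarrow>
    (\<forall>t\<ge>0. \<forall>f\<in>Lp_space M q. P t f \<in> Lp_space M q \<and> Lp_norm M q (P t f) \<le> Lp_norm M q f) \<and>
    (\<forall>t\<ge>0. \<forall>f\<in>Lp_space M q. \<forall>g\<in>Lp_space M q. \<forall>a b.
      AE x in M. P t (\<lambda>y. a * f y + b * g y) x = a * P t f x + b * P t g x) \<and>
    (\<forall>f\<in>Lp_space M q. AE x in M. P 0 f x = f x) \<and>
    (\<forall>s\<ge>0. \<forall>t\<ge>0. \<forall>f\<in>Lp_space M q. AE x in M. P (s + t) f x = P s (P t f) x)"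

definition positive_on ::
    "'a measure \<Rightarrow> ennreal \<Rightarrow> (real \<Rightarrow> ('a \<Rightarrow> real) \<Rightarrow> 'a \<Rightarrow> real) \<Rightarrow> bool" where
  "positive_on M q P \<longleftrightarrow>
    (\<forall>t\<ge>0. \<forall>f\<in>Lp_space M q. (AE x in M. 0 \<le> f x) \<longrightarrow> (AE x in M. 0 \<le> P t f x))"

definition strongly_continuous_L2 ::
    "'a measure \<Rightarrow> (real \<Rightarrow> ('a \<Rightarrow> real) \<Rightarrow> 'a \<Rightarrow> real) \<Rightarrow> bool" where
  "strongly_continuous_L2 M P \<longleftrightarrow>
    (\<forall>f\<in>Lp_space M 2. ((\<lambda>t. Lp_norm M 2 (\<lambda>x. P t f x - f x)) \<longlongrightarrow> 0) (at_right 0))"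

text \<open>
  Unbounded operators on \<open>L\<^sup>2\<close> are given by their graphs; \<open>form_generator\<close> is the operator \<open>L\<close>
  determined by \<open>E f v = - \<langle>L f, v\<rangle>\<close> for all \<open>v \<in> F\<close>.
\<close>

definition semigroup_generator ::
    "'a measure \<Rightarrow> (real \<Rightarrow> ('a \<Rightarrow> real) \<Rightarrow> 'a \<Rightarrow> real) \<Rightarrow> ('a \<Rightarrow> real) \<Rightarrow> ('a \<Rightarrow> real) \<Rightarrow> bool" where
  "semigroup_generator M P f g \<longleftrightarrow>
    f \<in> Lp_space M 2 \<and> g \<in> Lp_space M 2 \<and>
    ((\<lambda>t. Lp_norm M 2 (\<lambda>x. (P t f x - f x) / t - g x)) \<longlongrightarrow> 0) (at_right 0)"

definition form_generator ::
    "'a measure \<Rightarrow> ('a \<Rightarrow> real) set \<Rightarrow> (('a \<Rightarrow> real) \<Rightarrow> ('a \<Rightarrow> real) \<Rightarrow> real)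
      \<Rightarrow> ('a \<Rightarrow> real) \<Rightarrow> ('a \<Rightarrow> real) \<Rightarrow> bool" where
  "form_generator M F E f g \<longleftrightarrow>
    f \<in> F \<and> g \<in> Lp_space M 2 \<and> (\<forall>v\<in>F. E f v = - L2_inner M g v)"

definition associated_semigroup ::
    "'a measure \<Rightarrow> ('a \<Rightarrow> real) set \<Rightarrow> (('a \<Rightarrow> real) \<Rightarrow> ('a \<Rightarrow> real) \<Rightarrow> real)
      \<Rightarrow> (real \<Rightarrow> ('a \<Rightarrow> real) \<Rightarrow> 'a \<Rightarrow> real) \<Rightarrow> bool" where
  "associated_semigroup M F E P \<longleftrightarrow>
    contraction_semigroup_on M 2 P \<and> strongly_continuous_L2 M P \<and>
    (\<forall>f g. semigroup_generator M P f g \<longleftrightarrow> form_generator M F E f g)"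

text \<open>
  The same function \<open>P\<close> acts on all the spaces \<open>L\<^sup>q\<close>, so that the extensions agree on
  intersections. For \<open>q < \<infinity>\<close> this determines them, since \<open>L\<^sup>2 \<inter> L\<^sup>q\<close> is dense in \<open>L\<^sup>q\<close>;
  on \<open>L\<^sup>\<infinity>\<close> the extension is the adjoint of the one on \<open>L\<^sup>1\<close>.
\<close>

definition extended_to_Lp ::
    "'a measure \<Rightarrow> (real \<Rightarrow> ('a \<Rightarrow> real) \<Rightarrow> 'a \<Rightarrow> real) \<Rightarrow> bool" where
  "extended_to_Lp M P \<longleftrightarrow>
    (\<forall>q\<ge>1. contraction_semigroup_on M q P \<and> positive_on M q P) \<and>
    (\<forall>t\<ge>0. \<forall>f\<in>Lp_space M \<infinity>. \<forall>g\<in>Lp_space M 1.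
      (\<integral>x. P t f x * g x \<partial>M) = (\<integral>x. f x * P t g x \<partial>M))"

definition conservative ::
    "'a measure \<Rightarrow> (real \<Rightarrow> ('a \<Rightarrow> real) \<Rightarrow> 'a \<Rightarrow> real) \<Rightarrow> bool" where
  "conservative M P \<longleftrightarrow> (\<forall>t\<ge>0. AE x in M. P t (\<lambda>_. 1) x = 1)"

definition heat_kernel_measures ::
    "'a measure \<Rightarrow> (real \<Rightarrow> ('a \<Rightarrow> real) \<Rightarrow> 'a \<Rightarrow> real) \<Rightarrow> (real \<Rightarrow> 'a \<Rightarrow> 'a measure) \<Rightarrow> bool" where
  "heat_kernel_measures M P \<kappa> \<longleftrightarrow>
    (\<forall>t>0. \<kappa> t \<in> measurable M (subprob_algebra M) \<and>
      (\<forall>f\<in>Lp_space M \<infinity>. AE y in M. P t f y = (\<integral>x. f x \<partial>\<kappa> t y)))"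

definition besov_seminorm ::
    "'a measure \<Rightarrow> (real \<Rightarrow> 'a \<Rightarrow> 'a measure) \<Rightarrow> real \<Rightarrow> real \<Rightarrow> ('a \<Rightarrow> real) \<Rightarrow> ennreal" where
  "besov_seminorm M \<kappa> p \<alpha> f =
    (SUP t\<in>{0<..}. ennreal (t powr (- \<alpha>)) *
      ennreal_powr (\<integral>\<^sup>+y. (\<integral>\<^sup>+x. ennreal (\<bar>f x - f y\<bar> powr p) \<partial>\<kappa> t y) \<partial>M) (1 / p))"

definition besov_space ::
    "'a measure \<Rightarrow> (real \<Rightarrow> 'a \<Rightarrow> 'a measure) \<Rightarrow> real \<Rightarrow> real \<Rightarrow> ('a \<Rightarrow> real) set" where
  "besov_space M \<kappa> p \<alpha> = {f \<in> Lp_space M (ennreal p). besov_seminorm M \<kappa> p \<alpha> f < \<infinity>}"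

end

theory Submission
  imports Defs
begin

text \<open>
  For bounded \<open>g\<close>, conservativeness makes the heat kernel measures probability measures, and
  Jensen's inequality for \<open>\<kappa> t y\<close> bounds \<open>\<bar>P t g y - g y\<bar>\<^sup>p\<close> by the inner integral of the Besov
  seminorm. The kernel representation is only available for bounded functions, so a general \<open>f\<close>
  is truncated to \<open>[-n, n]\<close>. Truncation is 1-Lipschitz and hence decreases the Besov energy; by
  \<open>L\<^sup>p\<close>-contractivity \<open>P t\<close> of the truncations converges to \<open>P t f\<close> almost everywhere along a
  subsequence, and Fatou's lemma gives the claim.
\<close>

lemma ennreal_powr_ennreal: "0 \<le> x \<Longrightarrow> ennreal_powr (ennreal x) a = ennreal (x powr a)"
  by (simp add: ennreal_powr_def)

lemma ennreal_powr_le_iff: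
  assumes "0 < a"
  shows "ennreal_powr x a \<le> ennreal_powr y a \<longleftrightarrow> x \<le> y"
proof (cases x; cases y)
  fix r s :: real
  assume "0 \<le> r" "x = ennreal r" "0 \<le> s" "y = ennreal s"
  then show ?thesis
    using assms powr_less_mono2[of a s r] powr_mono2[of a r s]
    by (auto simp: ennreal_powr_ennreal ennreal_le_iff) (meson linorder_not_le)
qed (simp_all add: ennreal_powr_def top_unique)

lemma ennreal_powr_less_top_iff [simp]: "ennreal_powr x a < top \<longleftrightarrow> x < top"
  by (auto simp: ennreal_powr_def less_top)

lemma Lp_norm_ennreal:
  assumes "0 \<le> p"
  shows "Lp_norm M (ennreal p) f = ennreal_powr (\<integral>\<^sup>+x. ennreal (\<bar>f x\<bar> powr p) \<partial>M) (1 / p)"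
  using assms by (simp add: Lp_norm_def)

lemma Lp_norm_ennreal_le_iff:
  assumes "0 < p"
  shows "Lp_norm M (ennreal p) f \<le> Lp_norm M (ennreal p) g \<longleftrightarrow>
    (\<integral>\<^sup>+x. ennreal (\<bar>f x\<bar> powr p) \<partial>M) \<le> (\<integral>\<^sup>+x. ennreal (\<bar>g x\<bar> powr p) \<partial>M)"
  using assms by (simp add: Lp_norm_ennreal ennreal_powr_le_iff)

lemma Lp_space_ennreal_iff:
  assumes "0 \<le> p"
  shows "f \<in> Lp_space M (ennreal p) \<longleftrightarrow>
    f \<in> borel_measurable M \<and> integrable M (\<lambda>x. \<bar>f x\<bar> powr p)"
  using assms by (auto simp: Lp_space_def Lp_norm_ennreal integrable_iff_bounded)

lemma Lp_space_mono:
  assumes "0 \<le> p" "f \<in> Lp_space M (ennreal p)" "g \<in> borel_measurable M" "\<And>x. \<bar>g x\<bar> \<le> \<bar>f x\<bar>"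
  shows "g \<in> Lp_space M (ennreal p)"
proof -
  have "integrable M (\<lambda>x. \<bar>g x\<bar> powr p)"
  proof (rule Bochner_Integration.integrable_bound)
    show "integrable M (\<lambda>x. \<bar>f x\<bar> powr p)"
      using assms by (simp add: Lp_space_ennreal_iff)
    show "(\<lambda>x. \<bar>g x\<bar> powr p) \<in> borel_measurable M"
      using assms(3) by measurable
    show "AE x in M. norm (\<bar>g x\<bar> powr p) \<le> norm (\<bar>f x\<bar> powr p)"
      using assms(1,4) by (simp add: powr_mono2)
  qed
  with assms show ?thesis by (simp add: Lp_space_ennreal_iff)
qed

text \<open>Gives bounded functions, in particular the constant 1, access to the kernel formula of
  \<open>heat_kernel_measures\<close>, whatever the total mass of \<open>M\<close>.\<close>

lemma bounded_in_Lp_space_top: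
  assumes "g \<in> borel_measurable M" "\<And>x. \<bar>g x\<bar> \<le> c"
  shows "g \<in> Lp_space M \<infinity>"
proof -
  have "esssup M (\<lambda>x. ennreal \<bar>g x\<bar>) \<le> ennreal c"
    using assms by (intro esssup_I) (auto intro: ennreal_leI)
  also have "\<dots> < \<infinity>" by simp
  finally show ?thesis using assms(1) by (simp add: Lp_space_def Lp_norm_def)
qed

text \<open>The triangle inequality and monotonicity of the power reduce the claim to convexity of
  \<open>r powr p\<close> on the nonnegative half-line.\<close>

lemma convex_on_abs_powr:
  assumes "1 \<le> p"
  shows "convex_on UNIV (\<lambda>x::real. \<bar>x\<bar> powr p)"
proof (rule convex_onI)
  fix s x y :: real
  assume s: "0 < s" "s < 1"
  have powr_le: "r powr p \<le> r" if "0 < r" "r < 1" for r :: real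
    using powr_mono'[of 1 p r] that assms by simp
  have "\<bar>(1 - s) *\<^sub>R x + s *\<^sub>R y\<bar> powr p \<le> ((1 - s) * \<bar>x\<bar> + s * \<bar>y\<bar>) powr p"
    using s assms by (intro powr_mono2) (auto intro!: order_trans[OF abs_triangle_ineq] simp: abs_mult)
  also have "\<dots> \<le> (1 - s) * \<bar>x\<bar> powr p + s * \<bar>y\<bar> powr p"
  \<comment> \<open>\<open>powr_convex\<close> serves for positive arguments. If one argument
    vanishes, multiplicativity of the power leaves only \<open>s powr p \<le> s\<close>, or the same
    for \<open>1 - s\<close>.\<close>
  proof (cases "x = 0 \<or> y = 0")
    case True
    then show ?thesis
      using s powr_le[of s] powr_le[of "1 - s"] by (auto simp: powr_mult intro!: mult_right_mono)
  next
    case False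
    then show ?thesis
      using convex_onD[OF powr_convex[OF assms], of s "\<bar>x\<bar>" "\<bar>y\<bar>"] s by simp
  qed
  finally show "\<bar>(1 - s) *\<^sub>R x + s *\<^sub>R y\<bar> powr p \<le> (1 - s) * \<bar>x\<bar> powr p + s * \<bar>y\<bar> powr p" .
qed simp

text \<open>On a probability space boundedness makes both \<open>g\<close> and its p-th power
  integrable, so Jensen's inequality applies. The right side is a nonnegative integral, to match the
  inner integral of the seminorm.\<close>

lemma (in prob_space) jensen_powr_bounded:
  fixes g :: "'a \<Rightarrow> real"
  assumes "1 \<le> p" and g [measurable]: "g \<in> borel_measurable M" and bnd: "\<And>x. \<bar>g x\<bar> \<le> c"
  shows "ennreal (\<bar>expectation g\<bar> powr p) \<le> (\<integral>\<^sup>+x. ennreal (\<bar>g x\<bar> powr p) \<partial>M)"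
proof -
  have int: "integrable M (\<lambda>x. \<bar>g x\<bar> powr p)"
    using assms(1) bnd
    by (intro integrable_const_bound[of _ "c powr p"]) (auto intro!: AE_I2 powr_mono2)
  have "\<bar>expectation g\<bar> powr p \<le> expectation (\<lambda>x. \<bar>g x\<bar> powr p)"
    using bnd int convex_on_abs_powr[OF assms(1)]
    by (intro jensens_inequality[of _ UNIV]) (auto intro!: integrable_const_bound[of _ c])
  then show ?thesis
    using int by (simp add: nn_integral_eq_integral ennreal_leI)
qed

text \<open>A priori the kernels are only subprobabilities; testing the kernel formula on the
  constant 1 identifies their total mass with \<open>P t 1\<close>.\<close>

lemma conservative_kernel_prob_space:
  assumes "conservative M P" "heat_kernel_measures M P \<kappa>" "0 < t"
  shows "AE y in M. prob_space (\<kappa> t y)"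
proof -
  have "AE y in M. P t (\<lambda>_. 1) y = 1"
    using assms by (simp add: conservative_def)
  moreover have "AE y in M. P t (\<lambda>_. 1) y = (\<integral>x. 1 \<partial>\<kappa> t y)"
    using assms bounded_in_Lp_space_top[of "\<lambda>_. 1" M 1]
    unfolding heat_kernel_measures_def by (auto simp del: lebesgue_integral_const)
  moreover have "AE y in M. subprob_space (\<kappa> t y)"
    using assms subprob_space_kernel[of "\<kappa> t" M M] by (auto simp: heat_kernel_measures_def)
  ultimately show ?thesis
  proof eventually_elim
    case (elim y)
    then interpret subprob_space "\<kappa> t y" by simp
    show ?case
      using elim by (intro prob_spaceI) (simp add: emeasure_eq_measure)
  qed
qed

lemma semigroup_energy_bound_bounded:
  assumes "conservative M P" and \<kappa>: "heat_kernel_measures M P \<kappa>" and "0 < t" "1 \<le> p"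
    and g: "g \<in> borel_measurable M" and bnd: "\<And>x. \<bar>g x\<bar> \<le> c"
  shows "(\<integral>\<^sup>+y. ennreal (\<bar>P t g y - g y\<bar> powr p) \<partial>M)
    \<le> (\<integral>\<^sup>+y. (\<integral>\<^sup>+x. ennreal (\<bar>g x - g y\<bar> powr p) \<partial>\<kappa> t y) \<partial>M)"
proof (rule nn_integral_mono_AE)
  have "AE y in M. P t g y = (\<integral>x. g x \<partial>\<kappa> t y)"
    using \<kappa> \<open>0 < t\<close> bounded_in_Lp_space_top[OF g bnd] by (simp add: heat_kernel_measures_def)
  moreover have "AE y in M. sets (\<kappa> t y) = sets M"
    using \<kappa> \<open>0 < t\<close> sets_kernel[of "\<kappa> t" M M] by (auto simp: heat_kernel_measures_def)
  ultimately show "AE y in M. ennreal (\<bar>P t g y - g y\<bar> powr p)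
      \<le> (\<integral>\<^sup>+x. ennreal (\<bar>g x - g y\<bar> powr p) \<partial>\<kappa> t y)"
    using conservative_kernel_prob_space[OF assms(1) \<kappa> \<open>0 < t\<close>]
  proof eventually_elim
    case (elim y)
    interpret prob_space "\<kappa> t y" by fact
    have [measurable]: "g \<in> borel_measurable (\<kappa> t y)"
      using g elim(2) by (simp cong: measurable_cong_sets)
    have "integrable (\<kappa> t y) g"
      using bnd by (intro integrable_const_bound[of _ c]) auto
    \<comment> \<open>Total mass one turns the number \<open>g y\<close> into its own mean, so the
      increment of the semigroup is the mean of \<open>g x - g y\<close>.\<close>
    then have "P t g y - g y = expectation (\<lambda>x. g x - g y)"
      using elim(1) by (simp add: prob_space)
    moreover have "\<bar>g x - g y\<bar> \<le> 2 * c" for x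
      using bnd[of x] bnd[of y] by linarith
    ultimately show ?case
      using jensen_powr_bounded[OF \<open>1 \<le> p\<close>, of "\<lambda>x. g x - g y" "2 * c"] by simp
  qed
qed

text \<open>Domination by \<open>f\<close> gives convergence of \<open>u n\<close> to
  \<open>f\<close> in the p-th mean, contractivity transfers it to the images under
  \<open>P t\<close>, and convergence in mean yields almost everywhere convergence along a
  subsequence.\<close>

lemma Lp_semigroup_AE_subseq:
  fixes u :: "nat \<Rightarrow> 'a \<Rightarrow> real"
  assumes sg: "contraction_semigroup_on M (ennreal p) P" and "0 < p" "0 \<le> t"
    and f: "f \<in> Lp_space M (ennreal p)" and u: "\<And>n. u n \<in> Lp_space M (ennreal p)"
    and dom: "\<And>n x. \<bar>f x - u n x\<bar> \<le> \<bar>f x\<bar>" and lim: "\<And>x. (\<lambda>n. u n x) \<longlonglongrightarrow> f x"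
  obtains r :: "nat \<Rightarrow> nat" where "strict_mono r" "AE x in M. (\<lambda>n. P t (u (r n)) x) \<longlonglongrightarrow> P t f x"
proof -
  define D where "D n x = f x - u n x" for n x
  have [measurable]: "f \<in> borel_measurable M" "u n \<in> borel_measurable M" for n
    using f u by (auto simp: Lp_space_def)
  have D: "D n \<in> Lp_space M (ennreal p)" for n
    using \<open>0 < p\<close> dom by (intro Lp_space_mono[OF _ f]) (auto simp: D_def[abs_def])
  have PD: "P t (D n) \<in> Lp_space M (ennreal p)"
    and PD_le: "Lp_norm M (ennreal p) (P t (D n)) \<le> Lp_norm M (ennreal p) (D n)" for n
    using sg D \<open>0 \<le> t\<close> by (auto simp: contraction_semigroup_on_def)
  have PD_int: "integrable M (\<lambda>x. \<bar>P t (D n) x\<bar> powr p)"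
    and D_int: "integrable M (\<lambda>x. \<bar>D n x\<bar> powr p)" for n
    using PD D \<open>0 < p\<close> by (auto simp: Lp_space_ennreal_iff)
  have "(\<lambda>n. \<integral>x. \<bar>D n x\<bar> powr p \<partial>M) \<longlonglongrightarrow> (\<integral>x. 0 \<partial>M)"
  proof (rule integral_dominated_convergence[where w = "\<lambda>x. \<bar>f x\<bar> powr p"])
    have "(\<lambda>n. \<bar>D n x\<bar> powr p) \<longlonglongrightarrow> 0" for x
    proof -
      have "(\<lambda>n. \<bar>D n x\<bar>) \<longlonglongrightarrow> \<bar>f x - f x\<bar>"
        unfolding D_def by (intro tendsto_intros lim)
      then show ?thesis
        using tendsto_powr'[of "\<lambda>n. \<bar>D n x\<bar>" 0 sequentially "\<lambda>_. p" p] \<open>0 < p\<close> by simp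
    qed
    then show "AE x in M. (\<lambda>n. \<bar>D n x\<bar> powr p) \<longlonglongrightarrow> 0" by simp
    show "AE x in M. norm (\<bar>D n x\<bar> powr p) \<le> \<bar>f x\<bar> powr p" for n
      using dom \<open>0 < p\<close> by (auto simp: D_def intro!: powr_mono2)
  qed (use f D \<open>0 < p\<close> in \<open>auto simp: Lp_space_ennreal_iff\<close>)
  then have D_lim: "(\<lambda>n. \<integral>x. \<bar>D n x\<bar> powr p \<partial>M) \<longlonglongrightarrow> 0" by simp
  have PD_int_le: "(\<integral>x. norm (\<bar>P t (D n) x\<bar> powr p) \<partial>M) \<le> (\<integral>x. \<bar>D n x\<bar> powr p \<partial>M)" for n
    using PD_le[of n] PD_int[of n] D_int[of n] \<open>0 < p\<close>
    by (simp add: Lp_norm_ennreal_le_iff nn_integral_eq_integral)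
  \<comment> \<open>Convergence in the p-th mean is phrased as L1 convergence of the p-th powers to
    0, the form from which \<open>tendsto_L1_AE_subseq\<close> extracts a subsequence.\<close>
  have "(\<lambda>n. \<integral>x. norm (\<bar>P t (D n) x\<bar> powr p) \<partial>M) \<longlonglongrightarrow> 0"
    by (rule tendsto_sandwich[OF _ _ tendsto_const D_lim])
      (simp_all only: PD_int_le always_eventually Bochner_Integration.integral_nonneg norm_ge_zero simp_thms)
  from tendsto_L1_AE_subseq[of M "\<lambda>n x. \<bar>P t (D n) x\<bar> powr p", OF PD_int this] obtain r :: "nat \<Rightarrow> nat"
    where r: "strict_mono r" "AE x in M. (\<lambda>n. \<bar>P t (D (r n)) x\<bar> powr p) \<longlonglongrightarrow> 0"
    by blast
  have "AE x in M. P t (\<lambda>x. 1 * f x + (-1) * u n x) x = 1 * P t f x + (-1) * P t (u n) x" for n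
    using sg f u[of n] \<open>0 \<le> t\<close> unfolding contraction_semigroup_on_def by blast
  then have "AE x in M. P t (D n) x = P t f x - P t (u n) x" for n
    by (simp add: D_def[abs_def])
  \<comment> \<open>Linearity of \<open>P t\<close> holds only off a null set depending on
    \<open>n\<close>; there are countably many of these, so one null set serves for all
    \<open>n\<close>.\<close>
  then have "AE x in M. \<forall>n. P t (D n) x = P t f x - P t (u n) x"
    by (simp add: AE_all_countable)
  with r(2) have "AE x in M. (\<lambda>n. P t (u (r n)) x) \<longlonglongrightarrow> P t f x"
  proof eventually_elim
    case (elim x)
    \<comment> \<open>Taking p-th roots removes the power; the limit stays 0 because
      \<open>0 powr (1 / p) = 0\<close>.\<close>
    have "(\<lambda>n. (\<bar>P t (D (r n)) x\<bar> powr p) powr (1 / p)) \<longlonglongrightarrow> 0 powr (1 / p)"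
      using \<open>0 < p\<close> elim(1) by (intro tendsto_powr') auto
    then have "(\<lambda>n. P t (D (r n)) x) \<longlonglongrightarrow> 0"
      using \<open>0 < p\<close> by (simp add: powr_powr tendsto_rabs_zero_iff)
    then have "(\<lambda>n. P t f x - P t (D (r n)) x) \<longlonglongrightarrow> P t f x - 0"
      by (intro tendsto_intros)
    then show ?case
      using elim(2) by simp
  qed
  with r(1) show ?thesis by (rule that)
qed

text \<open>The energy of \<open>f\<close> bounds that of every truncation uniformly in
  \<open>n\<close>, so the bound survives the passage to the limit. Both sides may be infinite
  here.\<close>

lemma semigroup_energy_bound:
  assumes sg: "contraction_semigroup_on M (ennreal p) P" and "conservative M P"
    and "heat_kernel_measures M P \<kappa>" and "0 < t" "1 \<le> p" and f: "f \<in> Lp_space M (ennreal p)"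
  shows "(\<integral>\<^sup>+y. ennreal (\<bar>P t f y - f y\<bar> powr p) \<partial>M)
    \<le> (\<integral>\<^sup>+y. (\<integral>\<^sup>+x. ennreal (\<bar>f x - f y\<bar> powr p) \<partial>\<kappa> t y) \<partial>M)" (is "_ \<le> ?B")
proof -
  define u where "u n x = max (- real n) (min (real n) (f x))" for n x
  have f_meas [measurable]: "f \<in> borel_measurable M"
    using f by (simp add: Lp_space_def)
  have u_meas [measurable]: "u n \<in> borel_measurable M" for n
    unfolding u_def[abs_def] by measurable
  have u: "u n \<in> Lp_space M (ennreal p)" for n
    using \<open>1 \<le> p\<close> by (intro Lp_space_mono[OF _ f]) (auto simp: u_def)
  have u_lim: "(\<lambda>n. u n x) \<longlonglongrightarrow> f x" for x
  proof (rule tendsto_eventually, rule eventually_sequentiallyI)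
    \<comment> \<open>From this index on the truncation leaves the value \<open>f x\<close>
      unchanged.\<close>
    fix n assume "nat \<lceil>\<bar>f x\<bar>\<rceil> \<le> n"
    then show "u n x = f x" unfolding u_def by linarith
  qed
  have "\<bar>f x - u n x\<bar> \<le> \<bar>f x\<bar>" for n x
    by (auto simp: u_def)
  with sg f u u_lim \<open>1 \<le> p\<close> \<open>0 < t\<close> obtain r where
    r: "strict_mono r" "AE x in M. (\<lambda>n. P t (u (r n)) x) \<longlonglongrightarrow> P t f x"
    by (auto elim!: Lp_semigroup_AE_subseq[of M p P t f u])
  have [measurable]: "P t (u n) \<in> borel_measurable M" for n
    using sg u[of n] \<open>0 < t\<close> by (auto simp: contraction_semigroup_on_def Lp_space_def)
  define h where "h n y = ennreal (\<bar>P t (u n) y - u n y\<bar> powr p)" for n y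
  have [measurable]: "h n \<in> borel_measurable M" for n
    unfolding h_def[abs_def] by measurable
  have h_le: "(\<integral>\<^sup>+y. h n y \<partial>M) \<le> ?B" for n
  proof -
    have "(\<integral>\<^sup>+y. h n y \<partial>M) \<le> (\<integral>\<^sup>+y. (\<integral>\<^sup>+x. ennreal (\<bar>u n x - u n y\<bar> powr p) \<partial>\<kappa> t y) \<partial>M)"
      unfolding h_def using assms
      by (intro semigroup_energy_bound_bounded[where c = n]) (auto simp: u_def)
    \<comment> \<open>Clamping to an interval is 1-Lipschitz, so the integrands compare
      pointwise.\<close>
    also have "\<dots> \<le> ?B"
      using \<open>1 \<le> p\<close>
      by (intro nn_integral_mono ennreal_leI powr_mono2) (auto simp: u_def)
    finally show ?thesis .
  qed
  \<comment> \<open>The integrands converge along \<open>r\<close>; writing the limit as a liminf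
    prepares Fatou's lemma.\<close>
  have "AE y in M. ennreal (\<bar>P t f y - f y\<bar> powr p) = liminf (\<lambda>n. h (r n) y)"
    using r(2)
  proof eventually_elim
    case (elim y)
    have "(\<lambda>n. u (r n) y) \<longlonglongrightarrow> f y"
      using LIMSEQ_subseq_LIMSEQ[OF u_lim r(1)] by (simp add: comp_def)
    then have "(\<lambda>n. h (r n) y) \<longlonglongrightarrow> ennreal (\<bar>P t f y - f y\<bar> powr p)"
      unfolding h_def using elim \<open>1 \<le> p\<close>
      by (intro tendsto_ennrealI tendsto_powr' tendsto_intros) auto
    then show ?case
      by (intro lim_imp_Liminf[symmetric]) auto
  qed
  then have "(\<integral>\<^sup>+y. ennreal (\<bar>P t f y - f y\<bar> powr p) \<partial>M) = (\<integral>\<^sup>+y. liminf (\<lambda>n. h (r n) y) \<partial>M)"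
    by (rule nn_integral_cong_AE)
  also have "\<dots> \<le> liminf (\<lambda>n. \<integral>\<^sup>+y. h (r n) y \<partial>M)"
    by (rule nn_integral_liminf) simp
  also have "\<dots> \<le> ?B"
    using h_le by (intro Liminf_le) (auto intro: always_eventually)
  finally show ?thesis .
qed

theorem lemma0p4:
  fixes M :: "'a::topological_space measure"
    and F :: "('a \<Rightarrow> real) set"
    and E :: "('a \<Rightarrow> real) \<Rightarrow> ('a \<Rightarrow> real) \<Rightarrow> real"
    and P :: "real \<Rightarrow> ('a \<Rightarrow> real) \<Rightarrow> 'a \<Rightarrow> real"
    and \<kappa> :: "real \<Rightarrow> 'a \<Rightarrow> 'a measure"
    and p \<alpha> t :: real
    and f :: "'a \<Rightarrow> real"
  assumes "radon_measure M"
    and "dirichlet_form M F E"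
    and "associated_semigroup M F E P"
    and "extended_to_Lp M P"
    and "conservative M P"
    and "heat_kernel_measures M P \<kappa>"
    and "1 \<le> p"
    and "0 < \<alpha>"
    and "f \<in> besov_space M \<kappa> p \<alpha>"
    and "0 \<le> t"
  shows "Lp_norm M (ennreal p) (\<lambda>x. P t f x - f x) \<le> ennreal (t powr \<alpha>) * besov_seminorm M \<kappa> p \<alpha> f"
\<comment> \<open>The kernels and the supremum in the seminorm concern positive times only. At time
  0 the left side vanishes because \<open>P 0 f = f\<close> almost everywhere.\<close>
proof (cases "t = 0")
  case True
  have sg: "contraction_semigroup_on M (ennreal p) P" and f: "f \<in> Lp_space M (ennreal p)"
    using assms by (auto simp: extended_to_Lp_def besov_space_def)
  then have "AE x in M. P 0 f x = f x"
    unfolding contraction_semigroup_on_def by blast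
  then have "(\<integral>\<^sup>+x. ennreal (\<bar>P 0 f x - f x\<bar> powr p) \<partial>M) = (\<integral>\<^sup>+x. 0 \<partial>M)"
    by (intro nn_integral_cong_AE) (auto elim: eventually_mono)
  then show ?thesis
    using True \<open>1 \<le> p\<close> by (simp add: Lp_norm_ennreal ennreal_powr_def)
next
  case False
  with \<open>0 \<le> t\<close> have "0 < t" by simp
  let ?B = "\<integral>\<^sup>+y. (\<integral>\<^sup>+x. ennreal (\<bar>f x - f y\<bar> powr p) \<partial>\<kappa> t y) \<partial>M"
  have sg: "contraction_semigroup_on M (ennreal p) P" and f: "f \<in> Lp_space M (ennreal p)"
    using assms by (auto simp: extended_to_Lp_def besov_space_def)
  have "Lp_norm M (ennreal p) (\<lambda>x. P t f x - f x) \<le> ennreal_powr ?B (1 / p)"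
    using semigroup_energy_bound[OF sg \<open>conservative M P\<close> \<open>heat_kernel_measures M P \<kappa>\<close> \<open>0 < t\<close> \<open>1 \<le> p\<close> f]
      \<open>1 \<le> p\<close> by (simp add: Lp_norm_ennreal ennreal_powr_le_iff)
  \<comment> \<open>The two powers of \<open>t\<close> multiply to 1 since \<open>t\<close> is
    positive; the bracketed product is the term at \<open>t\<close> of the supremum defining the
    seminorm.\<close>
  also have "\<dots> = ennreal (t powr \<alpha>) * (ennreal (t powr (- \<alpha>)) * ennreal_powr ?B (1 / p))"
    using \<open>0 < t\<close> by (simp flip: mult.assoc ennreal_mult powr_add)
  also have "\<dots> \<le> ennreal (t powr \<alpha>) * besov_seminorm M \<kappa> p \<alpha> f"
    unfolding besov_seminorm_def using \<open>0 < t\<close> by (intro mult_left_mono SUP_upper) auto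
  finally show ?thesis .
qed

end
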